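(* Let $R$ be a commutative ring with nonzero identity and let $S$ be a multiplicatively closed subset of $R$ with $0\notin S$. If $R$ is an $OAF$-ring, then the ring of fractions $S^{-1}R$ is an $OAF$-ring. In particular, if $R$ is an $OAF$-ring, then the localization $R_M$ is an $OAF$-ring for every maximal ideal $M$ of $R$.
   Context: All rings are commutative with nonzero identity. An ideal $I$ of a ring $R$ is proper if $I\neq R$. A proper ideal $I$ of $R$ is an $OA$-ideal ($1$-absorbing prime ideal) if whenever $a,b,c\in R$ are nonunits with $abc\in I$, then $ab\in I$ or $c\in I$. A ring is an $OAF$-ring if every proper ideal is a finite product (of at least one factor) of $OA$-ideals. A multiplicatively closed subset is understood in the usual sense for forming rings of fractions (contains $1$ and is closed under multiplication). *)

theory Defs
  imports "HOL-Algebra.Ideal_Product"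
begin

section \<open>1-absorbing prime ideals and OAF-rings\<close>

locale OA_ideal = ideal + cring +
  assumes I_notcarr: "carrier R \<noteq> I"
    and I_absorbing: "\<lbrakk>a \<in> carrier R - Units R; b \<in> carrier R - Units R; c \<in> carrier R - Units R;
      a \<otimes> b \<otimes> c \<in> I\<rbrakk> \<Longrightarrow> a \<otimes> b \<in> I \<or> c \<in> I"

text \<open>The unit ideal is neutral for the product of ideals, so for \<open>Js = [J\<^sub>1, \<dots>, J\<^sub>n]\<close> the fold below
  is the usual product of the ideals \<open>J\<^sub>1, \<dots>, J\<^sub>n\<close>.\<close>

definition ideal_prod_list :: "('a, 'b) ring_scheme \<Rightarrow> 'a set list \<Rightarrow> 'a set" where
  "ideal_prod_list R Js = foldr (ideal_prod R) Js (carrier R)"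

locale OAF_ring = cring +
  assumes one_not_zero: "\<one> \<noteq> \<zero>"
    and OA_factorization: "\<lbrakk>ideal I R; I \<noteq> carrier R\<rbrakk> \<Longrightarrow>
      \<exists>Js. Js \<noteq> [] \<and> (\<forall>J \<in> set Js. OA_ideal J R) \<and> I = ideal_prod_list R Js"


section \<open>Rings of fractions\<close>

text \<open>Zero divisors are allowed in \<open>S\<close>, hence the extra factor \<open>t\<close> in the equivalence of fractions.\<close>

definition frac_rel :: "('a, 'b) ring_scheme \<Rightarrow> 'a set \<Rightarrow> (('a \<times> 'a) \<times> ('a \<times> 'a)) set" where
  "frac_rel R S = {((r, s), (r', s')). r \<in> carrier R \<and> r' \<in> carrier R \<and> s \<in> S \<and> s' \<in> S \<and>
     (\<exists>t \<in> S. t \<otimes>\<^bsub>R\<^esub> (s' \<otimes>\<^bsub>R\<^esub> r \<ominus>\<^bsub>R\<^esub> s \<otimes>\<^bsub>R\<^esub> r') = \<zero>\<^bsub>R\<^esub>)}"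

definition fraction :: "('a, 'b) ring_scheme \<Rightarrow> 'a set \<Rightarrow> 'a \<Rightarrow> 'a \<Rightarrow> ('a \<times> 'a) set" where
  "fraction R S r s = frac_rel R S `` {(r, s)}"

text \<open>The operations are lifted to classes by taking unions over all representatives; by
  \<open>mult_fraction\<close> and \<open>add_fraction\<close> below each such union is a single class.\<close>

definition frac_ring :: "('a, 'b) ring_scheme \<Rightarrow> 'a set \<Rightarrow> ('a \<times> 'a) set ring" where
  "frac_ring R S = \<lparr>
     carrier = (carrier R \<times> S) // frac_rel R S,
     mult = (\<lambda>X Y. \<Union>(r, s) \<in> X. \<Union>(r', s') \<in> Y.
               fraction R S (r \<otimes>\<^bsub>R\<^esub> r') (s \<otimes>\<^bsub>R\<^esub> s')),
     one = fraction R S \<one>\<^bsub>R\<^esub> \<one>\<^bsub>R\<^esub>,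
     zero = fraction R S \<zero>\<^bsub>R\<^esub> \<one>\<^bsub>R\<^esub>,
     add = (\<lambda>X Y. \<Union>(r, s) \<in> X. \<Union>(r', s') \<in> Y.
              fraction R S (r \<otimes>\<^bsub>R\<^esub> s' \<oplus>\<^bsub>R\<^esub> r' \<otimes>\<^bsub>R\<^esub> s) (s \<otimes>\<^bsub>R\<^esub> s'))\<rparr>"

definition localization :: "('a, 'b) ring_scheme \<Rightarrow> 'a set \<Rightarrow> ('a \<times> 'a) set ring" where
  "localization R P = frac_ring R (carrier R - P)"


subsection \<open>Basic facts\<close>

locale mult_closed_subset = cring R + S: submonoid S R for R (structure) and S
begin

lemma S_carr: "s \<in> S \<Longrightarrow> s \<in> carrier R"
  using S.subset by blast

lemma frac_rel_iff:
  "((r, s), (r', s')) \<in> frac_rel R S \<longleftrightarrow> r \<in> carrier R \<and> r' \<in> carrier R \<and> s \<in> S \<and> s' \<in> S \<and>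
     (\<exists>t \<in> S. t \<otimes> s' \<otimes> r = t \<otimes> s \<otimes> r')"
proof -
  have "t \<otimes> (s' \<otimes> r \<ominus> s \<otimes> r') = \<zero> \<longleftrightarrow> t \<otimes> s' \<otimes> r = t \<otimes> s \<otimes> r'"
    if [simp]: "r \<in> carrier R" "r' \<in> carrier R" "s \<in> carrier R" "s' \<in> carrier R" "t \<in> carrier R" for t
  proof -
    have "t \<otimes> (s' \<otimes> r \<ominus> s \<otimes> r') = t \<otimes> s' \<otimes> r \<ominus> t \<otimes> s \<otimes> r'"
      using that by algebra
    moreover have "t \<otimes> s' \<otimes> r = (t \<otimes> s' \<otimes> r \<ominus> t \<otimes> s \<otimes> r') \<oplus> t \<otimes> s \<otimes> r'"
      using that by algebra
    moreover have "t \<otimes> s \<otimes> r' \<ominus> t \<otimes> s \<otimes> r' = \<zero>"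
      using that by algebra
    ultimately show ?thesis using that by (metis l_zero m_closed)
  qed
  then show ?thesis unfolding frac_rel_def using S_carr by auto
qed

lemma equiv_frac_rel: "equiv (carrier R \<times> S) (frac_rel R S)"
proof (rule equivI)
  show "frac_rel R S \<subseteq> (carrier R \<times> S) \<times> (carrier R \<times> S)"
    unfolding frac_rel_def by auto
  show "refl_on (carrier R \<times> S) (frac_rel R S)"
    by (rule refl_onI) (auto simp: frac_rel_iff)
  show "sym (frac_rel R S)"
    by (rule symI) (auto simp: frac_rel_iff, metis)
  show "trans (frac_rel R S)"
  proof (rule transI, clarify)
    fix a s b u c v
    assume "((a, s), (b, u)) \<in> frac_rel R S" "((b, u), (c, v)) \<in> frac_rel R S"
    then obtain t w where h: "a \<in> carrier R" "b \<in> carrier R" "c \<in> carrier R"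
      "s \<in> S" "u \<in> S" "v \<in> S" "t \<in> S" "w \<in> S"
      "t \<otimes> u \<otimes> a = t \<otimes> s \<otimes> b" "w \<otimes> v \<otimes> b = w \<otimes> u \<otimes> c"
      by (auto simp: frac_rel_iff)
    note c = h(1-3) h(4-8)[THEN S_carr]
    have "(t \<otimes> w \<otimes> u) \<otimes> v \<otimes> a = w \<otimes> v \<otimes> (t \<otimes> u \<otimes> a)" using c by algebra
    also have "\<dots> = t \<otimes> s \<otimes> (w \<otimes> v \<otimes> b)" unfolding h(9) using c by algebra
    also have "\<dots> = (t \<otimes> w \<otimes> u) \<otimes> s \<otimes> c" unfolding h(10) using c by algebra
    finally show "((a, s), (c, v)) \<in> frac_rel R S"
      using h by (auto simp: frac_rel_iff intro!: bexI[of _ "t \<otimes> w \<otimes> u"])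
  qed
qed

lemma fraction_eq_iff:
  assumes "r \<in> carrier R" "s \<in> S" "r' \<in> carrier R" "s' \<in> S"
  shows "fraction R S r s = fraction R S r' s' \<longleftrightarrow> (\<exists>t \<in> S. t \<otimes> s' \<otimes> r = t \<otimes> s \<otimes> r')"
  unfolding fraction_def using eq_equiv_class_iff[OF equiv_frac_rel, of "(r, s)" "(r', s')"] assms
  by (simp add: frac_rel_iff)

lemma fraction_closed [simp]:
  "\<lbrakk>r \<in> carrier R; s \<in> S\<rbrakk> \<Longrightarrow> fraction R S r s \<in> carrier (frac_ring R S)"
  unfolding fraction_def frac_ring_def by (auto intro: quotientI)

lemma frac_ring_cases:
  assumes "X \<in> carrier (frac_ring R S)"
  obtains r s where "r \<in> carrier R" "s \<in> S" "X = fraction R S r s"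
  using assms unfolding fraction_def frac_ring_def by (auto elim!: quotientE)

lemma one_frac_ring: "\<one>\<^bsub>frac_ring R S\<^esub> = fraction R S \<one> \<one>"
  and zero_frac_ring: "\<zero>\<^bsub>frac_ring R S\<^esub> = fraction R S \<zero> \<one>"
  by (simp_all add: frac_ring_def)

lemma mult_fraction:
  assumes "r \<in> carrier R" "s \<in> S" "r' \<in> carrier R" "s' \<in> S"
  shows "fraction R S r s \<otimes>\<^bsub>frac_ring R S\<^esub> fraction R S r' s' = fraction R S (r \<otimes> r') (s \<otimes> s')"
proof -
  have "(\<lambda>p q. case p of (r, s) \<Rightarrow> case q of (r', s') \<Rightarrow> fraction R S (r \<otimes> r') (s \<otimes> s'))
    respects2 frac_rel R S"
  proof (rule congruent2_commuteI[OF equiv_frac_rel])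
    fix p q show "p \<in> carrier R \<times> S \<Longrightarrow> q \<in> carrier R \<times> S \<Longrightarrow>
      (case p of (r, s) \<Rightarrow> case q of (r', s') \<Rightarrow> fraction R S (r \<otimes> r') (s \<otimes> s')) =
      (case q of (r, s) \<Rightarrow> case p of (r', s') \<Rightarrow> fraction R S (r \<otimes> r') (s \<otimes> s'))"
      by (auto simp: m_comm S_carr)
  next
    fix p q w assume "w \<in> carrier R \<times> S" "(p, q) \<in> frac_rel R S"
    then obtain r s r' s' a u t where e: "w = (a, u)" "p = (r, s)" "q = (r', s')"
      and h: "a \<in> carrier R" "r \<in> carrier R" "r' \<in> carrier R" "u \<in> S" "s \<in> S" "s' \<in> S" "t \<in> S"
      and t: "t \<otimes> s' \<otimes> r = t \<otimes> s \<otimes> r'"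
      by (cases w, cases p, cases q) (auto simp: frac_rel_iff)
    note c = h(1-3) h(4-7)[THEN S_carr]
    have "t \<otimes> (u \<otimes> s') \<otimes> (a \<otimes> r) = u \<otimes> a \<otimes> (t \<otimes> s' \<otimes> r)" using c by algebra
    also have "\<dots> = t \<otimes> (u \<otimes> s) \<otimes> (a \<otimes> r')" unfolding t using c by algebra
    finally show "(case w of (r, s) \<Rightarrow> case p of (r', s') \<Rightarrow> fraction R S (r \<otimes> r') (s \<otimes> s')) =
      (case w of (r, s) \<Rightarrow> case q of (r', s') \<Rightarrow> fraction R S (r \<otimes> r') (s \<otimes> s'))"
      unfolding e using h by (auto simp: fraction_eq_iff)
  qed
  from UN_equiv_class2[OF equiv_frac_rel equiv_frac_rel this, of "(r, s)" "(r', s')"] assms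
  show ?thesis by (simp add: frac_ring_def fraction_def[of _ _ r s] fraction_def[of _ _ r' s'] split_def)
qed

lemma add_fraction:
  assumes "r \<in> carrier R" "s \<in> S" "r' \<in> carrier R" "s' \<in> S"
  shows "fraction R S r s \<oplus>\<^bsub>frac_ring R S\<^esub> fraction R S r' s' =
    fraction R S (r \<otimes> s' \<oplus> r' \<otimes> s) (s \<otimes> s')"
proof -
  have "(\<lambda>p q. case p of (r, s) \<Rightarrow> case q of (r', s') \<Rightarrow> fraction R S (r \<otimes> s' \<oplus> r' \<otimes> s) (s \<otimes> s'))
    respects2 frac_rel R S"
  proof (rule congruent2_commuteI[OF equiv_frac_rel])
    fix p q show "p \<in> carrier R \<times> S \<Longrightarrow> q \<in> carrier R \<times> S \<Longrightarrow>
      (case p of (r, s) \<Rightarrow> case q of (r', s') \<Rightarrow> fraction R S (r \<otimes> s' \<oplus> r' \<otimes> s) (s \<otimes> s')) =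
      (case q of (r, s) \<Rightarrow> case p of (r', s') \<Rightarrow> fraction R S (r \<otimes> s' \<oplus> r' \<otimes> s) (s \<otimes> s'))"
      by (auto simp: m_comm a_comm S_carr)
  next
    fix p q w assume "w \<in> carrier R \<times> S" "(p, q) \<in> frac_rel R S"
    then obtain r s r' s' a u t where e: "w = (a, u)" "p = (r, s)" "q = (r', s')"
      and h: "a \<in> carrier R" "r \<in> carrier R" "r' \<in> carrier R" "u \<in> S" "s \<in> S" "s' \<in> S" "t \<in> S"
      and t: "t \<otimes> s' \<otimes> r = t \<otimes> s \<otimes> r'"
      by (cases w, cases p, cases q) (auto simp: frac_rel_iff)
    note c = h(1-3) h(4-7)[THEN S_carr]
    have "t \<otimes> (u \<otimes> s') \<otimes> (a \<otimes> s \<oplus> r \<otimes> u) = t \<otimes> u \<otimes> s' \<otimes> a \<otimes> s \<oplus> u \<otimes> u \<otimes> (t \<otimes> s' \<otimes> r)"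
      using c by algebra
    also have "\<dots> = t \<otimes> (u \<otimes> s) \<otimes> (a \<otimes> s' \<oplus> r' \<otimes> u)" unfolding t using c by algebra
    finally show "(case w of (r, s) \<Rightarrow> case p of (r', s') \<Rightarrow> fraction R S (r \<otimes> s' \<oplus> r' \<otimes> s) (s \<otimes> s')) =
      (case w of (r, s) \<Rightarrow> case q of (r', s') \<Rightarrow> fraction R S (r \<otimes> s' \<oplus> r' \<otimes> s) (s \<otimes> s'))"
      unfolding e using h c by (auto simp: fraction_eq_iff)
  qed
  from UN_equiv_class2[OF equiv_frac_rel equiv_frac_rel this, of "(r, s)" "(r', s')"] assms
  show ?thesis by (simp add: frac_ring_def fraction_def[of _ _ r s] fraction_def[of _ _ r' s'] split_def)
qed

lemma fraction_eqI:
  assumes "r \<in> carrier R" "s \<in> S" "r' \<in> carrier R" "s' \<in> S" "s' \<otimes> r = s \<otimes> r'"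
  shows "fraction R S r s = fraction R S r' s'"
  using assms by (auto simp: fraction_eq_iff S_carr intro!: bexI[of _ \<one>])

lemma cring_frac_ring: "cring (frac_ring R S)"
proof (rule cringI)
  show "abelian_group (frac_ring R S)"
  proof (rule abelian_groupI, goal_cases)
    case (1 x y) then show ?case
      by (elim frac_ring_cases) (auto simp: add_fraction S_carr)
  next
    case 2 show ?case by (simp add: zero_frac_ring)
  next
    case (3 x y z) then show ?case
    proof (elim frac_ring_cases, clarify)
      fix a s b t c u assume h: "a \<in> carrier R" "b \<in> carrier R" "c \<in> carrier R" "s \<in> S" "t \<in> S" "u \<in> S"
      note c = h(1-3) h(4-6)[THEN S_carr]
      show "fraction R S a s \<oplus>\<^bsub>frac_ring R S\<^esub> fraction R S b t \<oplus>\<^bsub>frac_ring R S\<^esub> fraction R S c u =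
        fraction R S a s \<oplus>\<^bsub>frac_ring R S\<^esub> (fraction R S b t \<oplus>\<^bsub>frac_ring R S\<^esub> fraction R S c u)"
        apply (simp add: add_fraction h c)
        apply (rule fraction_eqI)
            apply (simp_all add: h c)
        using c apply algebra
        done
    qed
  next
    case (4 x y) then show ?case
      by (elim frac_ring_cases) (simp add: add_fraction m_comm a_comm S_carr)
  next
    case (5 x) then show ?case
      by (elim frac_ring_cases) (simp add: zero_frac_ring add_fraction S_carr)
  next
    case (6 x) then show ?case
    proof (elim frac_ring_cases)
      fix a s assume h: "a \<in> carrier R" "s \<in> S" "x = fraction R S a s"
      note c = h(1) h(2)[THEN S_carr]
      have e: "\<ominus> a \<otimes> s \<oplus> a \<otimes> s = \<zero>" using c by algebra
      have "fraction R S (\<ominus> a) s \<oplus>\<^bsub>frac_ring R S\<^esub> x = \<zero>\<^bsub>frac_ring R S\<^esub>"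
        unfolding h(3) zero_frac_ring using h c e by (simp add: add_fraction, intro fraction_eqI) auto
      then show ?thesis using h by (intro bexI[of _ "fraction R S (\<ominus> a) s"]) auto
    qed
  qed
  show "comm_monoid (frac_ring R S)"
  proof (rule comm_monoidI, goal_cases)
    case (1 x y) then show ?case
      by (elim frac_ring_cases) (auto simp: mult_fraction S_carr)
  next
    case 2 show ?case by (simp add: one_frac_ring)
  next
    case (3 x y z) then show ?case
      by (elim frac_ring_cases) (simp add: mult_fraction m_assoc S_carr)
  next
    case (4 x) then show ?case
      by (elim frac_ring_cases) (simp add: one_frac_ring mult_fraction S_carr)
  next
    case (5 x y) then show ?case
      by (elim frac_ring_cases) (simp add: mult_fraction m_comm S_carr)
  qed
  show "(x \<oplus>\<^bsub>frac_ring R S\<^esub> y) \<otimes>\<^bsub>frac_ring R S\<^esub> z =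
      x \<otimes>\<^bsub>frac_ring R S\<^esub> z \<oplus>\<^bsub>frac_ring R S\<^esub> y \<otimes>\<^bsub>frac_ring R S\<^esub> z"
    if "x \<in> carrier (frac_ring R S)" "y \<in> carrier (frac_ring R S)" "z \<in> carrier (frac_ring R S)" for x y z
    using that
  proof (elim frac_ring_cases, clarify)
    fix a s b t c u assume h: "a \<in> carrier R" "b \<in> carrier R" "c \<in> carrier R" "s \<in> S" "t \<in> S" "u \<in> S"
    note c = h(1-3) h(4-6)[THEN S_carr]
    show "(fraction R S a s \<oplus>\<^bsub>frac_ring R S\<^esub> fraction R S b t) \<otimes>\<^bsub>frac_ring R S\<^esub> fraction R S c u =
      fraction R S a s \<otimes>\<^bsub>frac_ring R S\<^esub> fraction R S c u \<oplus>\<^bsub>frac_ring R S\<^esub>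
      fraction R S b t \<otimes>\<^bsub>frac_ring R S\<^esub> fraction R S c u"
      apply (simp add: add_fraction mult_fraction h c)
      apply (rule fraction_eqI)
          apply (simp_all add: h c)
      using c apply algebra
      done
  qed
qed

lemma one_frac_ring_eq_zero_iff: "\<one>\<^bsub>frac_ring R S\<^esub> = \<zero>\<^bsub>frac_ring R S\<^esub> \<longleftrightarrow> \<zero> \<in> S"
  unfolding one_frac_ring zero_frac_ring by (auto simp: fraction_eq_iff S_carr)

end

end

theory Submission
  imports Defs "HOL-Algebra.Divisibility" "HOL-Algebra.QuotRing"
begin

text \<open>Extending an OA-ideal \<open>I\<close> along \<open>R \<rightarrow> S\<inverse>R\<close> gives an OA-ideal or the unit ideal: if the product of
  nonunits \<open>a/s\<close>, \<open>b/t\<close>, \<open>c/u\<close> lies in \<open>S\<inverse>I\<close>, then \<open>a b (w c) \<in> I\<close> for some \<open>w \<in> S\<close>, where \<open>a\<close>, \<open>b\<close> and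
  \<open>w c\<close> are nonunits of \<open>R\<close>. Every ideal of \<open>S\<inverse>R\<close> is the extension of its contraction, and extension
  commutes with products. So factoring the contraction, extending the factors and discarding those
  that become the unit ideal gives the factorization in \<open>S\<inverse>R\<close>.\<close>

section \<open>Products of lists of ideals\<close>

lemma ideal_prod_list_simps [simp]:
  "ideal_prod_list R [] = carrier R"
  "ideal_prod_list R (J # Js) = ideal_prod R J (ideal_prod_list R Js)"
  by (simp_all add: ideal_prod_list_def)

context cring
begin

lemma ideal_prod_list_is_ideal:
  "(\<And>J. J \<in> set Js \<Longrightarrow> ideal J R) \<Longrightarrow> ideal (ideal_prod_list R Js) R"
  by (induction Js) (simp_all add: oneideal ideal_prod_is_ideal)

lemma ideal_prod_one_left:
  "ideal I R \<Longrightarrow> carrier R \<cdot> I = I"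
  by (metis ideal_prod_commute ideal_prod_one oneideal)

text \<open>The unit ideal is neutral for the product. In the ring of fractions this discards the
  factors that extend to the whole ring.\<close>

lemma ideal_prod_list_filter:
  "(\<And>J. J \<in> set Js \<Longrightarrow> ideal J R) \<Longrightarrow>
    ideal_prod_list R (filter (\<lambda>J. J \<noteq> carrier R) Js) = ideal_prod_list R Js"
  by (induction Js) (auto simp: ideal_prod_one_left ideal_prod_list_is_ideal)

end

section \<open>Extension and contraction of ideals\<close>

definition ideal_ext :: "('a, 'b) ring_scheme \<Rightarrow> 'a set \<Rightarrow> 'a set \<Rightarrow> ('a \<times> 'a) set set" where
  "ideal_ext R S I = {fraction R S r s |r s. r \<in> I \<and> s \<in> S}"

definition ideal_contr :: "('a, 'b) ring_scheme \<Rightarrow> 'a set \<Rightarrow> ('a \<times> 'a) set set \<Rightarrow> 'a set" where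
  "ideal_contr R S J = {r \<in> carrier R. fraction R S r \<one>\<^bsub>R\<^esub> \<in> J}"

context mult_closed_subset
begin

abbreviation F where "F \<equiv> frac_ring R S"

sublocale F: cring F
  by (rule cring_frac_ring)

lemma ideal_extI: "\<lbrakk>r \<in> I; s \<in> S\<rbrakk> \<Longrightarrow> fraction R S r s \<in> ideal_ext R S I"
  by (auto simp: ideal_ext_def)

text \<open>A fraction can have one numerator in \<open>I\<close> and another outside it, so
  \<open>a \<in> I\<close> is too strong a criterion. Equality of fractions determines the numerator
  only up to factors from \<open>S\<close>, which \<open>w\<close> absorbs.\<close>

lemma fraction_in_ideal_ext:
  assumes I: "ideal I R" and h: "a \<in> carrier R" "s \<in> S"
  shows "fraction R S a s \<in> ideal_ext R S I \<longleftrightarrow> (\<exists>w\<in>S. w \<otimes> a \<in> I)"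
proof
  interpret I: ideal I R by fact
  assume "fraction R S a s \<in> ideal_ext R S I"
  then obtain r u where ru: "r \<in> I" "u \<in> S" "fraction R S a s = fraction R S r u"
    by (auto simp: ideal_ext_def)
  then obtain t where "t \<in> S" "t \<otimes> u \<otimes> a = t \<otimes> s \<otimes> r"
    using h by (auto simp: fraction_eq_iff)
  \<comment> \<open>The witness works because \<open>t \<otimes> u \<otimes> a\<close> equals
    \<open>t \<otimes> s \<otimes> r\<close>, a multiple of \<open>r \<in> I\<close>.\<close>
  with ru h show "\<exists>w\<in>S. w \<otimes> a \<in> I"
    by (intro bexI[of _ "t \<otimes> u"]) (auto simp: S_carr I.I_l_closed)
next
  assume "\<exists>w\<in>S. w \<otimes> a \<in> I"
  then obtain w where w: "w \<in> S" "w \<otimes> a \<in> I" by blast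
  then have "fraction R S a s = fraction R S (w \<otimes> a) (w \<otimes> s)"
    using h by (intro fraction_eqI) (auto simp: S_carr m_ac)
  with w h show "fraction R S a s \<in> ideal_ext R S I"
    by (auto simp: ideal_ext_def)
qed

text \<open>Any two fractions have a common denominator, so a sum of fractions with numerators in
  \<open>I\<close> is again a single such fraction. Hence the set is the ideal generated by the
  image of \<open>I\<close>.\<close>

lemma ideal_ext_ideal:
  assumes I: "ideal I R"
  shows "ideal (ideal_ext R S I) F"
proof -
  interpret I: ideal I R by fact
  have sub: "x \<in> carrier F" if "x \<in> ideal_ext R S I" for x
    using that by (auto simp: ideal_ext_def)
  have mult: "x \<otimes>\<^bsub>F\<^esub> y \<in> ideal_ext R S I" if "x \<in> carrier F" "y \<in> ideal_ext R S I" for x y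
  proof -
    obtain a s where "a \<in> carrier R" "s \<in> S" "x = fraction R S a s"
      using frac_ring_cases \<open>x \<in> carrier F\<close> by blast
    moreover obtain r t where "r \<in> I" "t \<in> S" "y = fraction R S r t"
      using \<open>y \<in> _\<close> by (auto simp: ideal_ext_def)
    ultimately show ?thesis
      by (simp add: mult_fraction ideal_extI I.I_l_closed)
  qed
  show ?thesis
  proof (rule idealI)
    show "subgroup (ideal_ext R S I) (add_monoid F)"
    proof (rule subgroup.intro)
      show "ideal_ext R S I \<subseteq> carrier (add_monoid F)"
        using sub by auto
      show "\<one>\<^bsub>add_monoid F\<^esub> \<in> ideal_ext R S I"
        by (simp add: zero_frac_ring ideal_extI)
    next
      fix x y assume "x \<in> ideal_ext R S I" "y \<in> ideal_ext R S I"
      then obtain a s b t where h: "a \<in> I" "s \<in> S" "x = fraction R S a s"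
          "b \<in> I" "t \<in> S" "y = fraction R S b t"
        by (auto simp: ideal_ext_def)
      then have "a \<otimes> t \<oplus> b \<otimes> s \<in> I"
        by (intro I.a_closed I.I_r_closed) (auto simp: S_carr)
      with h show "x \<otimes>\<^bsub>add_monoid F\<^esub> y \<in> ideal_ext R S I"
        by (auto simp: add_fraction ideal_ext_def)
    next
      fix x assume x: "x \<in> ideal_ext R S I"
      \<comment> \<open>Negation is multiplication by minus one, so closure follows from
        \<open>mult\<close>.\<close>
      have "\<ominus>\<^bsub>F\<^esub> x = (\<ominus>\<^bsub>F\<^esub> \<one>\<^bsub>F\<^esub>) \<otimes>\<^bsub>F\<^esub> x"
        using sub[OF x] by (simp add: F.l_minus)
      also have "\<dots> \<in> ideal_ext R S I"
        using x by (intro mult) auto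
      finally show "inv\<^bsub>add_monoid F\<^esub> x \<in> ideal_ext R S I"
        by (simp add: a_inv_def)
    qed
  next
    fix x y assume "x \<in> ideal_ext R S I" "y \<in> carrier F"
    then show "y \<otimes>\<^bsub>F\<^esub> x \<in> ideal_ext R S I" "x \<otimes>\<^bsub>F\<^esub> y \<in> ideal_ext R S I"
      using mult[of y x] sub by (auto simp: F.m_comm)
  qed (rule F.ring_axioms)
qed

lemma ideal_ext_carrier: "ideal_ext R S (carrier R) = carrier F"
  by (auto simp: ideal_ext_def elim!: frac_ring_cases)

text \<open>Both inclusions go by induction on how elements of the ideal product are built from
  products of two elements and sums.\<close>

lemma ideal_ext_prod:
  assumes I: "ideal I R" and J: "ideal J R"
  shows "ideal_ext R S (I \<cdot> J) = ideal_ext R S I \<cdot>\<^bsub>F\<^esub> ideal_ext R S J"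
proof
  interpret I: ideal I R by fact
  interpret J: ideal J R by fact
  interpret EP: ideal "ideal_ext R S (I \<cdot> J)" F
    by (intro ideal_ext_ideal ideal_prod_is_ideal I J)
  interpret PE: ideal "ideal_ext R S I \<cdot>\<^bsub>F\<^esub> ideal_ext R S J" F
    by (intro F.ideal_prod_is_ideal ideal_ext_ideal I J)
  show "ideal_ext R S I \<cdot>\<^bsub>F\<^esub> ideal_ext R S J \<subseteq> ideal_ext R S (I \<cdot> J)"
  proof
    fix x assume "x \<in> ideal_ext R S I \<cdot>\<^bsub>F\<^esub> ideal_ext R S J"
    then show "x \<in> ideal_ext R S (I \<cdot> J)"
    proof induction
      case (prod i j)
      then obtain a s b t where "a \<in> I" "s \<in> S" "i = fraction R S a s"
          "b \<in> J" "t \<in> S" "j = fraction R S b t"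
        by (auto simp: ideal_ext_def)
      then show ?case
        by (simp add: mult_fraction ideal_extI ideal_prod.prod)
    next
      case (sum x y)
      then show ?case by (intro EP.a_closed)
    qed
  qed
  have "fraction R S r s \<in> ideal_ext R S I \<cdot>\<^bsub>F\<^esub> ideal_ext R S J" if "r \<in> I \<cdot> J" "s \<in> S" for r s
    using that(1)
  proof induction
    case (prod i j)
    \<comment> \<open>The whole denominator is assigned to the first factor.\<close>
    have "fraction R S (i \<otimes> j) s = fraction R S i s \<otimes>\<^bsub>F\<^esub> fraction R S j \<one>"
      using prod \<open>s \<in> S\<close> by (simp add: mult_fraction S_carr)
    with prod \<open>s \<in> S\<close> show ?case
      by (simp add: ideal_extI ideal_prod.prod)
  next
    case (sum x y)
    have c: "x \<in> carrier R" "y \<in> carrier R" "s \<in> carrier R"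
      using sum ideal_prod_in_carrier[OF I J] \<open>s \<in> S\<close> by (auto simp: S_carr)
    \<comment> \<open>\<open>add_fraction\<close> produces the denominator
      \<open>s \<otimes> s\<close> even when both summands have denominator \<open>s\<close>; this
      identity cancels the extra \<open>s\<close>.\<close>
    have "s \<otimes> s \<otimes> (x \<oplus> y) = s \<otimes> (x \<otimes> s \<oplus> y \<otimes> s)"
      using c by algebra
    then have "fraction R S (x \<oplus> y) s = fraction R S (x \<otimes> s \<oplus> y \<otimes> s) (s \<otimes> s)"
      by (rule fraction_eqI[rotated 4]) (use c \<open>s \<in> S\<close> in auto)
    then have "fraction R S (x \<oplus> y) s = fraction R S x s \<oplus>\<^bsub>F\<^esub> fraction R S y s"
      using c \<open>s \<in> S\<close> by (simp add: add_fraction)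
    with sum show ?case by (simp add: PE.a_closed)
  qed
  then show "ideal_ext R S (I \<cdot> J) \<subseteq> ideal_ext R S I \<cdot>\<^bsub>F\<^esub> ideal_ext R S J"
    by (auto simp: ideal_ext_def[of R S "I \<cdot> J"])
qed

lemma ideal_ext_prod_list:
  "(\<And>J. J \<in> set Js \<Longrightarrow> ideal J R) \<Longrightarrow>
    ideal_ext R S (ideal_prod_list R Js) = ideal_prod_list F (map (ideal_ext R S) Js)"
  by (induction Js) (simp_all add: ideal_ext_carrier ideal_ext_prod ideal_prod_list_is_ideal)

text \<open>The contraction is the preimage of \<open>J\<close> under the canonical homomorphism
  sending \<open>r\<close> to \<open>r/1\<close>.\<close>

lemma ideal_contr_ideal:
  assumes J: "ideal J F"
  shows "ideal (ideal_contr R S J) R"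
proof -
  have "(\<lambda>r. fraction R S r \<one>) \<in> ring_hom R F"
    by (rule ring_hom_memI) (auto simp: mult_fraction add_fraction one_frac_ring)
  then interpret h: ring_hom_ring R F "\<lambda>r. fraction R S r \<one>"
    by (intro ring_hom_ringI2 ring_axioms F.ring_axioms)
  show ?thesis
    unfolding ideal_contr_def using h.ideal_vimage[OF J] .
qed

text \<open>The elements \<open>r/s\<close> and \<open>r/1\<close> differ by the unit
  \<open>s/1\<close>, so an ideal contains both or neither.\<close>

lemma ideal_ext_contr:
  assumes J: "ideal J F"
  shows "ideal_ext R S (ideal_contr R S J) = J"
proof
  interpret J: ideal J F by fact
  show "ideal_ext R S (ideal_contr R S J) \<subseteq> J"
  proof
    fix x assume "x \<in> ideal_ext R S (ideal_contr R S J)"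
    then obtain r s where h: "r \<in> carrier R" "fraction R S r \<one> \<in> J" "s \<in> S" "x = fraction R S r s"
      by (auto simp: ideal_ext_def ideal_contr_def)
    then have "x = fraction R S \<one> s \<otimes>\<^bsub>F\<^esub> fraction R S r \<one>"
      by (simp add: mult_fraction S_carr)
    also have "\<dots> \<in> J"
      using h by (intro J.I_l_closed) auto
    finally show "x \<in> J" .
  qed
  show "J \<subseteq> ideal_ext R S (ideal_contr R S J)"
  proof
    fix x assume x: "x \<in> J"
    then obtain r s where h: "r \<in> carrier R" "s \<in> S" "x = fraction R S r s"
      using frac_ring_cases J.Icarr by blast
    then have "fraction R S r \<one> = fraction R S s \<one> \<otimes>\<^bsub>F\<^esub> x"
      by (simp add: mult_fraction S_carr, intro fraction_eqI) (auto simp: S_carr)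
    also have "\<dots> \<in> J"
      using h x by (intro J.I_l_closed) (auto simp: S_carr)
    finally show "x \<in> ideal_ext R S (ideal_contr R S J)"
      using h by (simp add: ideal_extI ideal_contr_def)
  qed
qed

section \<open>Nonunits and OA-ideals in the ring of fractions\<close>

lemma fraction_Units:
  assumes "a \<in> Units R" "s \<in> S"
  shows "fraction R S a s \<in> Units F"
proof -
  have c: "a \<in> carrier R" "s \<in> carrier R" "s \<otimes> inv a \<in> carrier R"
    using assms by (auto simp: S_carr)
  \<comment> \<open>The inverse of \<open>a/s\<close> will be
    \<open>(s \<otimes> inv a)/1\<close>.\<close>
  have "s \<otimes> inv a \<otimes> a = s"
    using assms(1) c by (simp add: m_assoc)
  then have "fraction R S (s \<otimes> inv a) \<one> \<otimes>\<^bsub>F\<^esub> fraction R S a s = fraction R S s s"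
    using assms(2) c by (simp add: mult_fraction)
  also have "\<dots> = \<one>\<^bsub>F\<^esub>"
    unfolding one_frac_ring using assms(2) c by (intro fraction_eqI) auto
  finally have "fraction R S (s \<otimes> inv a) \<one> \<otimes>\<^bsub>F\<^esub> fraction R S a s = \<one>\<^bsub>F\<^esub>" .
  then show ?thesis
    using F.unit_factor[of "fraction R S a s" "fraction R S (s \<otimes> inv a) \<one>"] assms(2) c
    by (simp add: F.m_comm)
qed

lemma OA_ideal_ext:
  assumes I: "OA_ideal I R" and proper: "ideal_ext R S I \<noteq> carrier F"
  shows "OA_ideal (ideal_ext R S I) F"
proof -
  interpret I: OA_ideal I R by fact
  show ?thesis
  proof (intro OA_ideal.intro OA_ideal_axioms.intro)
    show "ideal (ideal_ext R S I) F" by (rule ideal_ext_ideal) (rule I.ideal_axioms)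
    show "carrier F \<noteq> ideal_ext R S I" using proper by simp
  next
    fix x y z
    assume xyz: "x \<in> carrier F - Units F" "y \<in> carrier F - Units F" "z \<in> carrier F - Units F"
      and m: "x \<otimes>\<^bsub>F\<^esub> y \<otimes>\<^bsub>F\<^esub> z \<in> ideal_ext R S I"
    obtain a s where x: "a \<in> carrier R" "s \<in> S" "x = fraction R S a s"
      using frac_ring_cases xyz(1) by blast
    obtain b t where y: "b \<in> carrier R" "t \<in> S" "y = fraction R S b t"
      using frac_ring_cases xyz(2) by blast
    obtain c u where z: "c \<in> carrier R" "u \<in> S" "z = fraction R S c u"
      using frac_ring_cases xyz(3) by blast
    \<comment> \<open>By contraposition of \<open>fraction_Units\<close>, nonunit fractions have
      nonunit numerators.\<close>
    have nu: "a \<notin> Units R" "b \<notin> Units R" "c \<notin> Units R"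
      using xyz x y z fraction_Units by auto
    obtain w where w: "w \<in> S" "w \<otimes> (a \<otimes> b \<otimes> c) \<in> I"
      using m x y z by (auto simp: mult_fraction fraction_in_ideal_ext I.ideal_axioms)
    note wc = S_carr[OF w(1)]
    \<comment> \<open>Moving \<open>w\<close> to the third factor keeps the absorbing property
      applicable to three nonunits; \<open>w \<otimes> c\<close> is one because every divisor of a
      unit is a unit.\<close>
    have "w \<otimes> (a \<otimes> b \<otimes> c) = a \<otimes> b \<otimes> (w \<otimes> c)"
      using x y z wc by algebra
    moreover have "w \<otimes> c \<notin> Units R"
      using nu(3) wc z(1) unit_factor[of c w] by (auto simp: m_comm)
    ultimately consider "a \<otimes> b \<in> I" | "w \<otimes> c \<in> I"
      using I.I_absorbing[of a b "w \<otimes> c"] w nu x y z wc by auto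
    then show "x \<otimes>\<^bsub>F\<^esub> y \<in> ideal_ext R S I \<or> z \<in> ideal_ext R S I"
    proof cases
      case 1
      with x y show ?thesis by (auto simp: mult_fraction ideal_ext_def)
    next
      case 2
      with w z show ?thesis by (auto simp: fraction_in_ideal_ext I.ideal_axioms)
    qed
  qed (rule cring_frac_ring)
qed

lemma OAF_ring_frac_ring:
  assumes R: "OAF_ring R" and S: "\<zero> \<notin> S"
  shows "OAF_ring F"
proof (intro OAF_ring.intro OAF_ring_axioms.intro cring_frac_ring)
  show "\<one>\<^bsub>F\<^esub> \<noteq> \<zero>\<^bsub>F\<^esub>" using S by (simp add: one_frac_ring_eq_zero_iff)
next
  fix J assume J: "ideal J F" "J \<noteq> carrier F"
  \<comment> \<open>Otherwise \<open>J\<close>, being the extension of its contraction, would be the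
    whole ring.\<close>
  then have "ideal_contr R S J \<noteq> carrier R"
    using ideal_ext_contr ideal_ext_carrier by metis
  then obtain Is where Is: "\<And>I. I \<in> set Is \<Longrightarrow> OA_ideal I R" "ideal_contr R S J = ideal_prod_list R Is"
    using OAF_ring.OA_factorization[OF R ideal_contr_ideal[OF J(1)]] by blast
  note ideals = OA_ideal.axioms(1)[OF Is(1)]
  define Js where "Js = filter (\<lambda>K. K \<noteq> carrier F) (map (ideal_ext R S) Is)"
  have "J = ideal_ext R S (ideal_prod_list R Is)"
    using ideal_ext_contr[OF J(1)] Is(2) by simp
  also have "\<dots> = ideal_prod_list F (map (ideal_ext R S) Is)"
    by (intro ideal_ext_prod_list ideals)
  also have "\<dots> = ideal_prod_list F Js"
    unfolding Js_def by (intro F.ideal_prod_list_filter[symmetric]) (auto intro: ideal_ext_ideal ideals)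
  finally have prod: "J = ideal_prod_list F Js" .
  \<comment> \<open>An empty product would be the unit ideal, but \<open>J\<close> is proper, so
    some factor survives the filter.\<close>
  with J(2) have "Js \<noteq> []" by auto
  moreover have "\<forall>K \<in> set Js. OA_ideal K F"
    by (auto simp: Js_def intro: OA_ideal_ext Is(1))
  ultimately show "\<exists>Js. Js \<noteq> [] \<and> (\<forall>K \<in> set Js. OA_ideal K F) \<and> J = ideal_prod_list F Js"
    using prod by blast
qed

end

text \<open>Primality is closure of the complement under products, and properness puts
  \<open>\<one>\<close> in it. This makes localization at a prime an instance of the general ring of
  fractions.\<close>

lemma (in primeideal) submonoid_compl: "submonoid (carrier R - I) R"
  using I_notcarr one_imp_carrier I_prime by (auto intro!: submonoid.intro)

theorem proposition2p3:
  fixes R :: "('a, 'b) ring_scheme" (structure)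
  assumes "OAF_ring R"
  shows "(\<forall>S. submonoid S R \<and> \<zero> \<notin> S \<longrightarrow> OAF_ring (frac_ring R S)) \<and>
         (\<forall>M. maximalideal M R \<longrightarrow> OAF_ring (localization R M))"
proof -
  interpret OAF_ring R by fact
  have frac: "OAF_ring (frac_ring R S)" if "submonoid S R" "\<zero> \<notin> S" for S
    using mult_closed_subset.OAF_ring_frac_ring[OF mult_closed_subset.intro] assms that cring_axioms
    by blast
  moreover have "OAF_ring (localization R M)" if M: "maximalideal M R" for M
  proof -
    interpret primeideal M R by (rule maximalideal_prime[OF M])
    show ?thesis
      \<comment> \<open>The remaining condition holds since zero lies in \<open>M\<close>, hence
        outside the complement.\<close>
      unfolding localization_def by (rule frac[OF submonoid_compl]) simp
  qed
  ultimately show ?thesis by blast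
qed

end
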